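(* Let $\mathbb{F}_q$ be a finite field with $q$ elements, $q$ odd, and let $L=\mathfrak{sl}_2(\mathbb{F}_q)$ be the Lie algebra of traceless $2\times 2$ matrices over $\mathbb{F}_q$. Then the number of triangles in the comaximal graph $\Gamma(L)$ is $$\mathfrak{t}(\Gamma(L)) = \frac{q^2(q^2-1)(q^2+3q+3)}{6}.$$
   Context: For a finite-dimensional Lie algebra $L$, the comaximal graph $\Gamma(L)$ is the simple undirected graph whose vertices are the proper nonzero Lie subalgebras of $L$; two distinct vertices $A,B$ are adjacent if and only if the Lie subalgebra $\langle A,B\rangle$ generated by $A\cup B$ equals $L$. A triangle of a graph is a set of three pairwise adjacent vertices, and $\mathfrak{t}(\Gamma)$ denotes the number of triangles of $\Gamma$. *)

theory Defs
  imports "HOL-Analysis.Analysis"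
begin

definition triangles :: "'v set \<Rightarrow> ('v \<Rightarrow> 'v \<Rightarrow> bool) \<Rightarrow> 'v set set" where
  "triangles V adj = {T. T \<subseteq> V \<and> card T = 3 \<and> pairwise adj T}"

text \<open>The underlying space of the Lie algebra is a subspace \<open>L\<close> of an ambient vector space, and the
  bracket is only constrained on \<open>L\<close>.\<close>

locale fin_dim_lie_algebra = vector_space scale
  for scale :: "'a::field \<Rightarrow> 'b::ab_group_add \<Rightarrow> 'b" (infixr \<open>*s\<close> 75) +
  fixes L :: "'b set" and bracket :: "'b \<Rightarrow> 'b \<Rightarrow> 'b"
  assumes subspace_L: "subspace L"
    and fin_dim_L: "\<exists>B. finite B \<and> span B = L"
    and bracket_closed: "\<lbrakk>x \<in> L; y \<in> L\<rbrakk> \<Longrightarrow> bracket x y \<in> L"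
    and bracket_add_left:
      "\<lbrakk>x \<in> L; y \<in> L; z \<in> L\<rbrakk> \<Longrightarrow> bracket (x + y) z = bracket x z + bracket y z"
    and bracket_add_right:
      "\<lbrakk>x \<in> L; y \<in> L; z \<in> L\<rbrakk> \<Longrightarrow> bracket x (y + z) = bracket x y + bracket x z"
    and bracket_scale_left: "\<lbrakk>x \<in> L; y \<in> L\<rbrakk> \<Longrightarrow> bracket (c *s x) y = c *s bracket x y"
    and bracket_scale_right: "\<lbrakk>x \<in> L; y \<in> L\<rbrakk> \<Longrightarrow> bracket x (c *s y) = c *s bracket x y"
    and bracket_self: "x \<in> L \<Longrightarrow> bracket x x = 0"
    and jacobi: "\<lbrakk>x \<in> L; y \<in> L; z \<in> L\<rbrakk> \<Longrightarrow>
      bracket x (bracket y z) + bracket y (bracket z x) + bracket z (bracket x y) = 0"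
begin

definition lie_subalgebra :: "'b set \<Rightarrow> bool" where
  "lie_subalgebra A \<longleftrightarrow> A \<subseteq> L \<and> subspace A \<and> (\<forall>x\<in>A. \<forall>y\<in>A. bracket x y \<in> A)"

definition comaximal_vertices :: "'b set set" where
  "comaximal_vertices = {A. lie_subalgebra A \<and> A \<noteq> {0} \<and> A \<noteq> L}"

definition comaximal_adj :: "'b set \<Rightarrow> 'b set \<Rightarrow> bool" where
  "comaximal_adj A B \<longleftrightarrow> A \<in> comaximal_vertices \<and> B \<in> comaximal_vertices \<and> A \<noteq> B \<and>
     lie_subalgebra hull (A \<union> B) = L"

definition num_triangles :: nat where
  "num_triangles = card (triangles comaximal_vertices comaximal_adj)"

end

definition commutator :: "'a::ring_1^'n^'n \<Rightarrow> 'a^'n^'n \<Rightarrow> 'a^'n^'n" where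
  "commutator A B = A ** B - B ** A"

definition sl2 :: "('a::field^2^2) set" where
  "sl2 = {A. trace A = 0}"

text \<open>The scalar action on matrices is entrywise: \<open>*s\<close> from the library would act on the rows with a
  vector as scalar, and \<open>*\<^sub>R\<close> is restricted to real scalars.\<close>

global_interpretation sl2: fin_dim_lie_algebra
  "\<lambda>c. map_matrix ((*) c)" "sl2 :: ('a::{field,finite}^2^2) set" commutator
proof -
  interpret V: vector_space "\<lambda>c::'a. map_matrix ((*) c) :: 'a^2^2 \<Rightarrow> 'a^2^2"
    by unfold_locales (simp_all add: vec_eq_iff algebra_simps)
  have sub: "V.subspace sl2"
    by (auto simp: V.subspace_def sl2_def trace_def simp flip: sum_distrib_left)
      (simp_all add: sum.distrib)
  show "fin_dim_lie_algebra (\<lambda>c. map_matrix ((*) c)) (sl2 :: ('a^2^2) set) commutator"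
  proof unfold_locales
    show "V.subspace sl2" by (fact sub)
    show "\<exists>B. finite B \<and> V.span B = sl2"
      using sub V.span_eq_iff finite[of "sl2 :: ('a^2^2) set"] by blast
  qed (simp_all add: sl2_def commutator_def trace_def sum_2 vec_eq_iff forall_2
        matrix_matrix_mult_def algebra_simps)
qed

end

theory Submission
  imports Defs "HOL-Combinatorics.Multiset_Permutations" "HOL-Number_Theory.Residues"
begin

text \<open>The trace form identifies the bracket with a cross product: \<open>[x, y]\<close> is orthogonal to \<open>x\<close> and
  \<open>y\<close>, so a plane is a subalgebra iff its normal is isotropic, i.e. nilpotent. Hence the vertices are
  the \<open>q\<^sup>2 + q + 1\<close> lines and the \<open>q + 1\<close> Borel subalgebras, the stabilisers of the points of the
  projective line. Label a vertex by its set of common eigenlines, i.e. by the Borel subalgebras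
  containing it. Two vertices are adjacent iff their labels are disjoint; every label has at most two
  elements, every singleton is the label of exactly two vertices (a Borel subalgebra and its nilpotent
  line), and every pair is the label of exactly one. These multiplicities and the number of vertices
  determine the number of triangles.\<close>

section \<open>Triangles in graphs of disjoint labels\<close>

text \<open>The weight depends only on the size of the label, so the sum is grouped by labels:
  inside \<open>R\<close> these are the empty set, the singletons and the pairs. The size of the
  fibre over the empty label stays unknown. The weights used later are the constant 1,
  \<open>d\<close> and \<open>H\<close>.\<close>

lemma sum_over_labels:
  fixes S :: "'v \<Rightarrow> 'p set" and g :: "nat \<Rightarrow> real"
  assumes "finite V" "finite R"
    and le2: "\<And>A. A \<in> V \<Longrightarrow> card (S A) \<le> 2"
    and one: "\<And>p. p \<in> R \<Longrightarrow> card {A \<in> V. S A = {p}} = 2"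
    and two: "\<And>p p'. \<lbrakk>p \<in> R; p' \<in> R; p \<noteq> p'\<rbrakk> \<Longrightarrow> card {A \<in> V. S A = {p, p'}} = 1"
  shows "(\<Sum>A \<in> {A \<in> V. S A \<subseteq> R}. g (card (S A))) =
    card {A \<in> V. S A = {}} * g 0 + 2 * real (card R) * g 1 + real (card R) * (real (card R) - 1) / 2 * g 2"
proof -
  let ?fib = "\<lambda>X. {A \<in> V. S A = X}"
  let ?T = "\<lambda>k. {X. X \<subseteq> R \<and> card X = k}"
  have fin: "finite (?T k)" for k using assms(2) by auto
  have "(\<Sum>A \<in> {A \<in> V. S A \<subseteq> R}. g (card (S A))) =
    (\<Sum>X \<in> ?T 0 \<union> ?T 1 \<union> ?T 2. \<Sum>A \<in> {A \<in> {A \<in> V. S A \<subseteq> R}. S A = X}. g (card (S A)))"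
  proof (rule sum.group[symmetric])
    show "S ` {A \<in> V. S A \<subseteq> R} \<subseteq> ?T 0 \<union> ?T 1 \<union> ?T 2"
      using le2 by (force simp: le_Suc_eq numeral_2_eq_2)
  qed (use fin assms in auto)
  also have "\<dots> = (\<Sum>X \<in> ?T 0 \<union> ?T 1 \<union> ?T 2. card (?fib X) * g (card X))"
  proof (rule sum.cong[OF refl])
    fix X assume "X \<in> ?T 0 \<union> ?T 1 \<union> ?T 2"
    then have "{A \<in> {A \<in> V. S A \<subseteq> R}. S A = X} = ?fib X" by auto
    then show "(\<Sum>A \<in> {A \<in> {A \<in> V. S A \<subseteq> R}. S A = X}. g (card (S A))) = card (?fib X) * g (card X)"
      by simp
  qed
  also have "\<dots> = (\<Sum>X\<in>?T 0. card (?fib X) * g (card X)) + (\<Sum>X\<in>?T 1. card (?fib X) * g (card X))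
      + (\<Sum>X\<in>?T 2. card (?fib X) * g (card X))"
    using fin by (subst sum.union_disjoint; (subst sum.union_disjoint)?) auto
  also have "?T 0 = {{}}" using assms(2) by (auto dest: finite_subset)
  also have "(\<Sum>X\<in>?T 1. card (?fib X) * g (card X)) = (\<Sum>X\<in>?T 1. 2 * g 1)"
    by (rule sum.cong) (auto simp: one card_1_singleton_iff)
  also have "(\<Sum>X\<in>?T 2. card (?fib X) * g (card X)) = (\<Sum>X\<in>?T 2. g 2)"
    by (rule sum.cong) (auto simp: two card_2_iff simp flip: numeral_2_eq_2)
  also have "(\<Sum>X\<in>?T 1. 2 * g 1) = 2 * real (card R) * g 1"
    by (simp only: sum_constant n_subsets[OF assms(2)]) simp
  also have "(\<Sum>X\<in>?T 2. g 2) = real (card R) * (real (card R) - 1) / 2 * g 2"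
    by (simp only: sum_constant n_subsets[OF assms(2)])
      (cases "card R"; simp add: choose_two real_of_nat_div algebra_simps)
  finally show ?thesis by simp
qed

text \<open>Each triangle has 3! orderings. Ordered triples are turned into lists, so that the
  orderings of \<open>T\<close> are \<open>permutations_of_set T\<close>. As \<open>adj\<close> may
  hold on the diagonal, the inequalities are explicit.\<close>

lemma six_times_card_triangles:
  assumes "finite V" and sym: "\<And>A B. adj A B \<Longrightarrow> adj B A"
  shows "6 * card (triangles V adj) =
    (\<Sum>A\<in>V. \<Sum>B\<in>{B\<in>V. B \<noteq> A \<and> adj A B}. card {C\<in>V. C \<noteq> A \<and> C \<noteq> B \<and> adj A C \<and> adj B C})"
proof -
  let ?X = "SIGMA A:V. SIGMA B:{B\<in>V. B \<noteq> A \<and> adj A B}. {C\<in>V. C \<noteq> A \<and> C \<noteq> B \<and> adj A C \<and> adj B C}"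
  have fin: "finite (triangles V adj)"
    unfolding triangles_def using assms(1) by auto
  have bij: "bij_betw (\<lambda>(A, B, C). [A, B, C]) ?X (\<Union>T\<in>triangles V adj. permutations_of_set T)"
    unfolding bij_betw_def
  proof
    show "inj_on (\<lambda>(A, B, C). [A, B, C]) ?X" by (auto simp: inj_on_def)
    show "(\<lambda>(A, B, C). [A, B, C]) ` ?X = (\<Union>T\<in>triangles V adj. permutations_of_set T)"
    proof
      show "(\<lambda>(A, B, C). [A, B, C]) ` ?X \<subseteq> (\<Union>T\<in>triangles V adj. permutations_of_set T)"
        by (auto simp: triangles_def permutations_of_set_def pairwise_def dest: sym)
      show "(\<Union>T\<in>triangles V adj. permutations_of_set T) \<subseteq> (\<lambda>(A, B, C). [A, B, C]) ` ?X"
      proof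
        fix xs assume "xs \<in> (\<Union>T\<in>triangles V adj. permutations_of_set T)"
        then have xs: "set xs \<subseteq> V" "card (set xs) = 3" "pairwise adj (set xs)" "distinct xs"
          by (auto simp: triangles_def permutations_of_set_def)
        then have "length xs = 3" using distinct_card by fastforce
        then obtain A B C where "xs = [A, B, C]"
          by (auto simp: numeral_3_eq_3 length_Suc_conv)
        then show "xs \<in> (\<lambda>(A, B, C). [A, B, C]) ` ?X"
          using xs by (auto simp: pairwise_def image_iff)
      qed
    qed
  qed
  have "card (\<Union>T\<in>triangles V adj. permutations_of_set T) =
    (\<Sum>T\<in>triangles V adj. card (permutations_of_set T))"
    by (rule card_UN_disjoint[OF fin]) (simp, auto simp: permutations_of_set_def)
  also have "\<dots> = (\<Sum>T\<in>triangles V adj. 6)"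
    by (intro sum.cong refl)
      (auto simp: triangles_def card_permutations_of_set fact_numeral card_ge_0_finite)
  finally have "card ?X = 6 * card (triangles V adj)"
    using bij_betw_same_card[OF bij] by simp
  then show ?thesis
    using assms(1) by (simp add: card_SigmaI finite_SigmaI)
qed

text \<open>Up to \<open>A\<close> and \<open>B\<close> themselves, the common neighbours of
  \<open>A\<close> and \<open>B\<close> are the vertices labelled inside the complement of
  \<open>S A \<union> S B\<close>. Their number depends only on the sizes of the two labels, so
  choosing the three vertices in turn gives a polynomial in \<open>q\<close>.\<close>

lemma card_triangles_disjoint_labels:
  fixes S :: "'v \<Rightarrow> 'p::finite set" and q :: real
  assumes fV: "finite V"
    and le2: "\<And>A. A \<in> V \<Longrightarrow> card (S A) \<le> 2"
    and one: "\<And>p. card {A \<in> V. S A = {p}} = 2"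
    and two: "\<And>p p'. p \<noteq> p' \<Longrightarrow> card {A \<in> V. S A = {p, p'}} = 1"
    and adj: "\<And>A B. \<lbrakk>A \<in> V; B \<in> V; A \<noteq> B\<rbrakk> \<Longrightarrow> adj A B \<longleftrightarrow> S A \<inter> S B = {}"
    and sym: "\<And>A B. adj A B \<Longrightarrow> adj B A"
    and cP: "CARD('p) = q + 1" and cV: "card V = q\<^sup>2 + 2 * q + 2"
  shows "card (triangles V adj) = q\<^sup>2 * (q\<^sup>2 - 1) * (q\<^sup>2 + 3 * q + 3) / 6"
proof -
  define e where "e = real (card {A \<in> V. S A = {}})"
  have label: "(\<Sum>A \<in> {A \<in> V. S A \<subseteq> R}. g (card (S A))) =
    e * g 0 + 2 * real (card R) * g 1 + real (card R) * (real (card R) - 1) / 2 * g 2"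
    for R and g :: "nat \<Rightarrow> real"
    unfolding e_def by (intro sum_over_labels fV le2 one two) auto
  have cardm: "real (card (- X)) = q + 1 - card X" for X :: "'p set"
    using cP card_mono[of UNIV X] by (simp add: Compl_eq_Diff_UNIV card_Diff_subset of_nat_diff)
  \<comment> \<open>\<open>c r\<close> counts the vertices whose label lies in a given set of
    \<open>r\<close> points. Taking all \<open>q + 1\<close> points and comparing with
    \<open>cV\<close> determines \<open>e\<close>.\<close>
  define c where "c r = e + 2 * r + r * (r - 1) / 2" for r :: real
  have c: "real (card {C \<in> V. S C \<subseteq> R}) = c (card R)" for R
    using label[where R = R and g = "\<lambda>_. 1"] by (simp add: c_def)
  have e: "e = q * (q - 1) / 2"
    using c[of UNIV] cV cP by (simp add: c_def power2_eq_square field_simps)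
  \<comment> \<open>\<open>d i j\<close> counts the common neighbours of two adjacent vertices with
    labels of sizes \<open>i\<close> and \<open>j\<close>. A vertex with empty label satisfies the
    disjointness condition with itself and has to be taken off.\<close>
  define d where "d i j = c (q + 1 - i - j) - of_bool (i = 0) - of_bool (j = 0)" for i j :: nat
  have inner: "real (card {C\<in>V. C \<noteq> A \<and> C \<noteq> B \<and> adj A C \<and> adj B C}) = d (card (S A)) (card (S B))"
    if AB: "A \<in> V" "B \<in> V" "B \<noteq> A" "S A \<inter> S B = {}" for A B
  proof -
    let ?Y = "{C \<in> V. S C \<subseteq> - (S A \<union> S B)}"
    let ?A = "if S A = {} then {A} else {}" and ?B = "if S B = {} then {B} else {}"
    have eq: "{C\<in>V. C \<noteq> A \<and> C \<noteq> B \<and> adj A C \<and> adj B C} = ?Y - (?A \<union> ?B)"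
    proof (rule Set.set_eqI)
      fix C
      show "C \<in> {C\<in>V. C \<noteq> A \<and> C \<noteq> B \<and> adj A C \<and> adj B C} \<longleftrightarrow> C \<in> ?Y - (?A \<union> ?B)"
        using AB adj[of A C] adj[of B C] by (cases "C = A"; cases "C = B") auto
    qed
    have sub: "?A \<union> ?B \<subseteq> ?Y" using AB by auto
    have "card (?A \<union> ?B) \<le> card ?Y" using sub fV by (intro card_mono) auto
    moreover have "card (S A \<union> S B) = card (S A) + card (S B)"
      using AB by (intro card_Un_disjoint) auto
    moreover have "real (card ?Y) = c (q + 1 - card (S A \<union> S B))"
      by (simp only: c cardm)
    ultimately show ?thesis
      using AB(3) unfolding eq by (subst card_Diff_subset[OF _ sub])
        (auto simp: d_def of_nat_diff algebra_simps)
  qed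
  \<comment> \<open>\<open>H i\<close> sums \<open>d\<close> over the neighbours of a vertex whose
    label has size \<open>i\<close>. The last term removes that vertex itself when its label is
    empty.\<close>
  define H where "H i = e * d i 0 + 2 * (q + 1 - i) * d i 1 + (q + 1 - i) * (q - i) / 2 * d i 2
      - of_bool (i = 0) * d i 0" for i :: nat
  have outer: "(\<Sum>B\<in>{B\<in>V. B \<noteq> A \<and> adj A B}.
      real (card {C\<in>V. C \<noteq> A \<and> C \<noteq> B \<and> adj A C \<and> adj B C})) = H (card (S A))"
    if A: "A \<in> V" for A
  proof -
    let ?Y = "{B \<in> V. S B \<subseteq> - S A}"
    let ?A = "if S A = {} then {A} else {}"
    have eq: "{B\<in>V. B \<noteq> A \<and> adj A B} = ?Y - ?A"
    proof (rule Set.set_eqI)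
      fix B
      show "B \<in> {B\<in>V. B \<noteq> A \<and> adj A B} \<longleftrightarrow> B \<in> ?Y - ?A"
        using A adj[of A B] by (cases "B = A") auto
    qed
    have sub: "?A \<subseteq> ?Y" using A by auto
    have "(\<Sum>B\<in>{B\<in>V. B \<noteq> A \<and> adj A B}.
      real (card {C\<in>V. C \<noteq> A \<and> C \<noteq> B \<and> adj A C \<and> adj B C})) =
      (\<Sum>B\<in>{B\<in>V. B \<noteq> A \<and> adj A B}. d (card (S A)) (card (S B)))"
      using A adj by (intro sum.cong refl inner) auto
    also have "\<dots> = (\<Sum>B\<in>?Y. d (card (S A)) (card (S B))) - (\<Sum>B\<in>?A. d (card (S A)) (card (S B)))"
      unfolding eq using sub fV by (intro sum_diff) auto
    also have "\<dots> = H (card (S A))"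
      unfolding label[where g = "d (card (S A))"] cardm H_def by simp
    finally show ?thesis .
  qed
  have "6 * real (card (triangles V adj)) = (\<Sum>A\<in>V. H (card (S A)))"
    using arg_cong[OF six_times_card_triangles[OF fV sym], where f = real] outer by simp
  also have "\<dots> = e * H 0 + 2 * (q + 1) * H 1 + (q + 1) * q / 2 * H 2"
    using label[where R = UNIV and g = H] cP by simp
  also have "\<dots> = q\<^sup>2 * (q\<^sup>2 - 1) * (q\<^sup>2 + 3 * q + 3)"
    unfolding H_def d_def c_def e by (simp add: field_simps power2_eq_square)
  finally show ?thesis by simp
qed

section \<open>Subalgebras of traceless matrices\<close>

definition traceless :: "'a::field \<Rightarrow> 'a \<Rightarrow> 'a \<Rightarrow> 'a^2^2" where
  "traceless a b c = vector [vector [a, b], vector [c, - a]]"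

abbreviation smult_mat :: "'a::field \<Rightarrow> 'a^2^2 \<Rightarrow> 'a^2^2" where
  "smult_mat k \<equiv> map_matrix ((*) k)"

lemma traceless_nth [simp]:
  "traceless a b c $ 1 $ 1 = a" "traceless a b c $ 1 $ 2 = b" "traceless a b c $ 2 $ 1 = c" "traceless a b c $ 2 $ 2 = - a"
  by (simp_all add: traceless_def)

lemma traceless_eq_iff [simp]: "traceless a b c = traceless a' b' c' \<longleftrightarrow> a = a' \<and> b = b' \<and> c = c'"
  by (auto simp: vec_eq_iff forall_2)

lemma traceless_in_sl2 [simp]: "traceless a b c \<in> sl2"
  by (simp add: sl2_def trace_def sum_2)

lemma sl2_cases:
  assumes "x \<in> sl2"
  obtains a b c where "x = traceless a b c"
proof
  show "x = traceless (x $ 1 $ 1) (x $ 1 $ 2) (x $ 2 $ 1)"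
    using assms by (simp add: sl2_def trace_def sum_2 vec_eq_iff forall_2 add_eq_0_iff)
qed

lemma traceless_zero: "traceless 0 0 0 = 0"
  by (simp add: vec_eq_iff forall_2)

lemma traceless_eq_0_iff [simp]: "traceless a b c = 0 \<longleftrightarrow> a = 0 \<and> b = 0 \<and> c = 0"
  by (simp flip: traceless_zero)

lemma traceless_add [simp]: "traceless a b c + traceless a' b' c' = traceless (a + a') (b + b') (c + c')"
  by (simp add: vec_eq_iff forall_2)

lemma traceless_smult [simp]: "smult_mat k (traceless a b c) = traceless (k * a) (k * b) (k * c)"
  by (simp add: vec_eq_iff forall_2)

lemma commutator_traceless [simp]:
  "commutator (traceless a b c) (traceless a' b' c') =
    traceless (b * c' - b' * c) (2 * (a * b' - a' * b)) (2 * (c * a' - c' * a))"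
  by (simp add: commutator_def vec_eq_iff forall_2 matrix_matrix_mult_def sum_2 algebra_simps)

lemma card_sl2: "card (sl2 :: ('a::{field,finite}^2^2) set) = CARD('a) ^ 3"
proof -
  have "bij_betw (\<lambda>(a, b, c). traceless a b c) UNIV (sl2 :: ('a^2^2) set)"
    by (auto simp: bij_betw_def inj_on_def image_iff elim!: sl2_cases)
  then have "card (sl2 :: ('a^2^2) set) = CARD('a \<times> 'a \<times> 'a)"
    by (metis bij_betw_same_card)
  then show ?thesis by (simp add: card_prod power3_eq_cube)
qed

section \<open>Eigenlines of a single matrix\<close>

text \<open>A line of the plane is encoded by \<open>'a option\<close>: \<open>Some t\<close> is spanned by \<open>(t, 1)\<close>
  and \<open>None\<close> by \<open>(1, 0)\<close>.
  \<open>eigenline_form p x\<close> is the determinant of \<open>x v\<close> and \<open>v\<close> for this spanning vector \<open>v\<close>, up to sign.\<close>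

primrec eigenline_form :: "'a::field option \<Rightarrow> 'a^2^2 \<Rightarrow> 'a" where
  "eigenline_form None x = x $ 2 $ 1"
| "eigenline_form (Some t) x = x $ 1 $ 2 + 2 * t * x $ 1 $ 1 - t\<^sup>2 * x $ 2 $ 1"

text \<open>In odd characteristic, the traceless matrix, unique up to scaling, whose eigenlines are exactly
  the two given ones; it is nilpotent when they coincide.\<close>

fun eigenlines_matrix :: "'a::field option \<Rightarrow> 'a option \<Rightarrow> 'a^2^2" where
  "eigenlines_matrix (Some s) (Some t) = traceless ((s + t) / 2) (- s * t) 1"
| "eigenlines_matrix (Some s) None = traceless 1 (- 2 * s) 0"
| "eigenlines_matrix None (Some t) = traceless 1 (- 2 * t) 0"
| "eigenlines_matrix None None = traceless 0 1 0"

text \<open>The form vanishes iff the spanning vector of \<open>p\<close> is an eigenvector of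
  \<open>x\<close> (eigenvalue 0 included), so this is the stabiliser of the line
  \<open>p\<close>.\<close>

definition borel_subalgebra :: "'a::field option \<Rightarrow> ('a^2^2) set" where
  "borel_subalgebra p = {x \<in> sl2. eigenline_form p x = 0}"

lemma eigenlines_matrix_in_sl2 [simp]: "eigenlines_matrix p p' \<in> sl2"
  by (cases p; cases p') auto

lemma eigenlines_matrix_neq_0 [simp]: "eigenlines_matrix p p' \<noteq> 0"
  by (cases p; cases p') auto

lemma eigenline_form_smult [simp]: "eigenline_form p (smult_mat k x) = k * eigenline_form p x"
  by (cases p) (simp_all add: algebra_simps)

text \<open>For a fixed matrix the form at \<open>Some r\<close> is a polynomial in \<open>r\<close>
  of degree at most 2 whose roots are the finite eigenlines. The degree drops once for each of
  \<open>p\<close>, \<open>p'\<close> that is \<open>None\<close>.\<close>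

lemma eigenline_form_eigenlines_matrix:
  assumes "(2::'a::field) \<noteq> 0"
  shows "eigenline_form r (eigenlines_matrix p p' :: 'a^2^2) = 0 \<longleftrightarrow> r = p \<or> r = p'"
proof -
  have *: "eigenline_form (Some r) (eigenlines_matrix (Some s) (Some t)) = - (r - s) * (r - t)" for r s t :: 'a
    using assms by (simp add: field_simps power2_eq_square)
  have **: "eigenline_form (Some r) (eigenlines_matrix (Some s) None) = 2 * (r - s)" for r s :: 'a
    by (simp add: algebra_simps)
  have ***: "eigenline_form (Some r) (eigenlines_matrix None (Some s)) = 2 * (r - s)" for r s :: 'a
    by (simp add: algebra_simps)
  show ?thesis
    using assms by (cases r; cases p; cases p') (auto simp only: * ** *** , auto)
qed

text \<open>A quadratic with one root in the field has its second root there too, so a traceless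
  matrix with one eigenline has a second one, possibly the same. The zero matrix is covered by
  \<open>k = 0\<close>.\<close>

lemma borel_subalgebra_factor:
  assumes "(2::'a::field) \<noteq> 0" and "x \<in> borel_subalgebra (p :: 'a option)"
  obtains p' k where "x = smult_mat k (eigenlines_matrix p p')"
proof -
  obtain a b c where x: "x = traceless a b c" using assms(2) by (auto simp: borel_subalgebra_def elim: sl2_cases)
  have "\<exists>p' k. x = smult_mat k (eigenlines_matrix p p')"
  proof (cases p)
    case None
    then have c: "c = 0" using assms(2) x by (simp add: borel_subalgebra_def)
    show ?thesis
    proof (cases "a = 0")
      case True
      then show ?thesis using None x c by (intro exI[of _ None] exI[of _ b]) simp
    next
      case False
      then show ?thesis using None x c assms(1)
        by (intro exI[of _ "Some (- b / (2 * a))"] exI[of _ a]) simp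
    qed
  next
    case (Some t)
    then have b: "b = t\<^sup>2 * c - 2 * t * a" using assms(2) x by (simp add: borel_subalgebra_def algebra_simps)
    show ?thesis
    proof (cases "c = 0")
      case True
      then show ?thesis using Some x b by (intro exI[of _ None] exI[of _ a]) simp
    next
      case False
      \<comment> \<open>The roots of the quadratic in \<open>t\<close> add up to
        \<open>2 * a / c\<close>, so this is the second root.\<close>
      then show ?thesis using Some x b assms(1)
        by (intro exI[of _ "Some (2 * a / c - t)"] exI[of _ c]) (simp add: field_simps power2_eq_square)
    qed
  qed
  then show thesis using that by blast
qed

section \<open>Generated subalgebras and lines in general\<close>

lemma (in fin_dim_lie_algebra) lie_subalgebra_L: "lie_subalgebra L"
  by (simp add: lie_subalgebra_def subspace_L bracket_closed)

text \<open>Intersections of subalgebras are subalgebras. The family intersected here contains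
  \<open>L\<close>, which keeps the hull inside \<open>L\<close>.\<close>

lemma (in fin_dim_lie_algebra) lie_subalgebra_hull:
  assumes "X \<subseteq> L"
  shows "lie_subalgebra (lie_subalgebra hull X)"
proof -
  have "lie_subalgebra hull X \<subseteq> L"
    by (rule hull_minimal[where S = lie_subalgebra and t = L]) (fact assms lie_subalgebra_L)+
  then show ?thesis
    unfolding lie_subalgebra_def[of "_ hull _"] hull_def
    by (auto intro!: subspace_Inter simp: lie_subalgebra_def)
qed

lemma (in fin_dim_lie_algebra) bracket_span_singleton:
  assumes "x \<in> L" "y \<in> span {x}" "z \<in> span {x}"
  shows "bracket y z = 0"
  using assms subspace_scale[OF subspace_L assms(1)]
  by (auto simp: span_singleton bracket_scale_left bracket_scale_right bracket_self)

lemma (in fin_dim_lie_algebra) lie_subalgebra_span_singleton: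
  assumes "x \<in> L"
  shows "lie_subalgebra (span {x})"
  using assms subspace_L bracket_span_singleton[OF assms]
  by (auto simp: lie_subalgebra_def span_zero intro: subsetD[OF span_minimal])

lemma (in vector_space) subspace_of_span_singleton:
  assumes "subspace A" "A \<subseteq> span {x}" "A \<noteq> {0}"
  shows "A = span {x}"
proof -
  obtain y where y: "y \<in> A" "y \<noteq> 0" using assms subspace_0 by blast
  then obtain k where k: "y = scale k x" using assms(2) by (auto simp: span_singleton)
  then have "x = scale (1 / k) y" using y by simp
  then have "x \<in> A" using y assms(1) subspace_scale by metis
  then show ?thesis using assms span_minimal[of "{x}" A] by auto
qed

lemma (in vector_space) span_singleton_eq:
  assumes "y \<in> span {x}" "y \<noteq> 0"
  shows "span {y} = span {x}"
proof (rule subspace_of_span_singleton[OF subspace_span])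
  show "span {y} \<subseteq> span {x}" using assms(1) by (intro span_minimal) auto
  show "span {y} \<noteq> {0}" using assms(2) span_base[of y "{y}"] by auto
qed

section \<open>The trace form\<close>

lemma trace_traceless_mult [simp]: "trace (traceless a b c ** traceless a' b' c') = 2 * a * a' + b * c' + c * b'"
  by (simp add: trace_def matrix_matrix_mult_def sum_2)

text \<open>This makes the stabiliser of \<open>p\<close> the orthogonal plane of the nilpotent
  matrix with eigenline \<open>p\<close>.\<close>

lemma eigenline_form_eq_trace:
  assumes "(2::'a::field) \<noteq> 0" "x \<in> sl2"
  shows "eigenline_form p x = trace (eigenlines_matrix p p ** x :: 'a^2^2)"
  using assms by (cases p) (auto elim!: sl2_cases simp: power2_eq_square algebra_simps)

text \<open>The trace of the square is -2 times the determinant, so an isotropic matrix is nilpotent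
  and has exactly one eigenline.\<close>

lemma null_is_eigenlines_matrix:
  assumes "(2::'a::field) \<noteq> 0" "n \<in> sl2" "trace (n ** n :: 'a^2^2) = 0" "n \<noteq> 0"
  obtains p k where "n = smult_mat k (eigenlines_matrix p p)" "k \<noteq> 0"
proof -
  obtain a b c where n: "n = traceless a b c" using assms(2) by (auto elim: sl2_cases)
  have "2 * (a * a + b * c) = 0" using assms(3) by (simp add: n algebra_simps)
  then have eq: "a * a + b * c = 0" using assms(1) by (metis mult_eq_0_iff)
  show thesis
  proof (cases "c = 0")
    case True
    then show ?thesis using eq assms(4) that[of b None] by (simp add: n)
  next
    case False
    then have "b = - (a * a) / c" using eq by (simp add: field_simps add_eq_0_iff)
    \<comment> \<open>The kernel of \<open>n\<close> is spanned by \<open>(a, c)\<close>, whence the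
      eigenline \<open>a / c\<close>.\<close>
    then show ?thesis using False assms(1) that[of c "Some (a / c)"]
      by (simp add: n field_simps)
  qed
qed

text \<open>Up to sign and factors 2, the entries of the commutator are the 2 by 2 minors of the two
  coordinate vectors; if all vanish, the vectors are proportional.\<close>

lemma commutator_eq_0_imp:
  assumes "(2::'a::{field,finite}) \<noteq> 0" "x \<in> sl2" "y \<in> sl2" "x \<noteq> 0"
    and "commutator x y = (0 :: 'a^2^2)"
  shows "y \<in> sl2.span {x}"
proof -
  obtain a b c a' b' c' where xy: "x = traceless a b c" "y = traceless a' b' c'"
    using assms(2,3) by (auto elim!: sl2_cases)
  have eq: "b * c' = b' * c" "a * b' = a' * b" "c * a' = c' * a"
    using assms(1,5) by (auto simp: xy)
  consider "a \<noteq> 0" | "b \<noteq> 0" | "c \<noteq> 0" using assms(4) xy by auto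
  then have "\<exists>k. y = smult_mat k x"
  proof cases
    case 1 then show ?thesis using eq by (intro exI[of _ "a' / a"]) (simp add: xy field_simps)
  next
    case 2 then show ?thesis using eq by (intro exI[of _ "b' / b"]) (simp add: xy field_simps)
  next
    case 3 then show ?thesis using eq by (intro exI[of _ "c' / c"]) (simp add: xy field_simps)
  qed
  then show ?thesis by (auto simp: sl2.span_singleton)
qed

text \<open>Cramer's rule: \<open>trace (commutator x y ** z)\<close> is twice the determinant of \<open>x, y, z\<close>.\<close>

lemma cramer_sl2:
  assumes "x \<in> sl2" "y \<in> sl2" "z \<in> sl2" "w \<in> sl2"
  shows "smult_mat (trace (commutator x y ** w)) z =
    smult_mat (trace (commutator z y ** w)) x + smult_mat (trace (commutator x z ** w)) y +
    smult_mat (trace (commutator x y ** z)) (w :: 'a::field^2^2)"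
  using assms by (elim sl2_cases) (simp add: algebra_simps)

lemma trace_form_nondegenerate:
  assumes "(2::'a::field) \<noteq> 0" "n \<in> sl2" "n \<noteq> 0"
  obtains w where "w \<in> sl2" "trace (n ** w :: 'a^2^2) \<noteq> 0"
proof -
  obtain a b c where n: "n = traceless a b c" using assms(2) by (auto elim: sl2_cases)
  then consider "a \<noteq> 0" | "b \<noteq> 0" | "c \<noteq> 0" using assms(3) by auto
  then show thesis
  proof cases
    case 1 then show ?thesis using assms(1) that[of "traceless 1 0 0"] by (simp add: n)
  next
    case 2 then show ?thesis using that[of "traceless 0 0 1"] by (simp add: n)
  next
    case 3 then show ?thesis using that[of "traceless 0 1 0"] by (simp add: n)
  qed
qed

lemma borel_subalgebra_eq_trace:
  assumes "(2::'a::field) \<noteq> 0"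
  shows "borel_subalgebra p = {x \<in> sl2. trace (eigenlines_matrix p p ** x) = (0::'a)}"
  using eigenline_form_eq_trace[OF assms] by (auto simp: borel_subalgebra_def)

lemma smult_mat_mult: "smult_mat k A ** B = smult_mat k (A ** B)"
  by (simp add: vec_eq_iff matrix_matrix_mult_def sum_distrib_left mult.assoc)

lemma trace_smult: "trace (smult_mat k A) = k * trace A"
  by (simp add: trace_def sum_distrib_left)

section \<open>Classification of the subalgebras\<close>

text \<open>Both inclusions come from Cramer's rule. An element of \<open>A\<close> not orthogonal
  to the commutator would form a basis together with \<open>x\<close> and \<open>y\<close>, making
  \<open>A\<close> everything; conversely, whatever is orthogonal to the commutator is a combination
  of \<open>x\<close> and \<open>y\<close>.\<close>

lemma subalgebra_eq_commutator_orthogonal: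
  assumes two: "(2::'a::{field,finite}) \<noteq> 0" and A: "sl2.lie_subalgebra A" "A \<noteq> sl2"
    and xy: "x \<in> A" "y \<in> A" "commutator x y \<noteq> 0"
  shows "A = {z \<in> sl2. trace (commutator x y ** z) = (0::'a)}"
proof -
  have sub: "A \<subseteq> sl2" "sl2.subspace A" using A by (auto simp: sl2.lie_subalgebra_def)
  note lin = sl2.subspace_add[OF sub(2)] sl2.subspace_scale[OF sub(2)]
  have cancel: "z \<in> A" if "smult_mat k z \<in> A" "k \<noteq> 0" for z and k :: 'a
  proof -
    have "smult_mat (1 / k) (smult_mat k z) = z"
      using that(2) by (simp add: vec_eq_iff)
    then show ?thesis using lin(2)[OF that(1), of "1 / k"] by metis
  qed
  have n: "commutator x y \<in> sl2"
    using xy sub(1) by (intro sl2.bracket_closed) auto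
  \<comment> \<open>By Cramer's rule this multiple of \<open>z\<close> is a combination of
    \<open>x\<close>, \<open>y\<close> and \<open>w\<close>, and the term in \<open>w\<close> lies
    in \<open>A\<close> by assumption.\<close>
  have combination: "smult_mat (trace (commutator x y ** w)) z \<in> A"
    if "z \<in> sl2" "w \<in> sl2" "smult_mat (trace (commutator x y ** z)) w \<in> A" for z w
    using xy sub(1) that by (subst cramer_sl2) (auto intro: lin)
  obtain w where w: "w \<in> sl2" "trace (commutator x y ** w) \<noteq> 0"
    using trace_form_nondegenerate[OF two n xy(3)] by metis
  have sup: "z \<in> A" if z: "z \<in> sl2" "trace (commutator x y ** z) = 0" for z
  proof (rule cancel[OF combination w(2)])
    show "smult_mat (trace (commutator x y ** z)) w \<in> A"
      unfolding z(2) sl2.scale_zero_left by (rule sl2.subspace_0[OF sub(2)])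
  qed (fact z w)+
  have "trace (commutator x y ** w) = 0" if w: "w \<in> A" for w
  proof (rule ccontr)
    assume *: "trace (commutator x y ** w) \<noteq> 0"
    have "z \<in> A" if "z \<in> sl2" for z
      using cancel[OF combination *] that w sub(1) lin(2) by auto
    then show False using A(2) sub(1) by auto
  qed
  then show ?thesis using sup sub(1) by auto
qed

text \<open>If \<open>A\<close> is abelian, it lies in the centraliser of any of its nonzero
  elements, which is a line. Otherwise it is the orthogonal plane of a commutator.\<close>

lemma lie_subalgebra_sl2_cases:
  assumes two: "(2::'a::{field,finite}) \<noteq> 0" and A: "sl2.lie_subalgebra A" "A \<noteq> sl2" "A \<noteq> {0::'a^2^2}"
  obtains x where "x \<in> sl2" "x \<noteq> 0" "A = sl2.span {x}" | p where "A = borel_subalgebra p"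
proof (cases "\<forall>x\<in>A. \<forall>y\<in>A. commutator x y = 0")
  case True
  have sub: "A \<subseteq> sl2" "sl2.subspace A" using A by (auto simp: sl2.lie_subalgebra_def)
  obtain x where x: "x \<in> A" "x \<noteq> 0" using A(3) sl2.subspace_0[OF sub(2)] by blast
  have "A \<subseteq> sl2.span {x}"
    using True x sub commutator_eq_0_imp[OF two] by blast
  then have "A = sl2.span {x}"
    using sub(2) A(3) by (intro sl2.subspace_of_span_singleton)
  then show thesis using that(1) x sub by blast
next
  case False
  then obtain x y where xy: "x \<in> A" "y \<in> A" "commutator x y \<noteq> 0" by blast
  note eq = subalgebra_eq_commutator_orthogonal[OF two A(1,2) xy]
  \<comment> \<open>The normal of the plane \<open>A\<close> lies in \<open>A\<close>, hence is
    orthogonal to itself.\<close>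
  have "commutator x y \<in> A" using xy A(1) by (auto simp: sl2.lie_subalgebra_def)
  then have "commutator x y \<in> sl2" "trace (commutator x y ** commutator x y) = 0"
    using eq by auto
  then obtain p k where pk: "commutator x y = smult_mat k (eigenlines_matrix p p)" "k \<noteq> 0"
    using null_is_eigenlines_matrix[OF two] xy(3) by metis
  have "A = borel_subalgebra p"
    unfolding eq pk borel_subalgebra_eq_trace[OF two] smult_mat_mult trace_smult using pk(2) by simp
  then show thesis by (rule that(2))
qed

lemma lie_subalgebra_borel_subalgebra: "sl2.lie_subalgebra (borel_subalgebra (p :: 'a::{field,finite} option))"
proof -
  have add: "eigenline_form p (x + y) = eigenline_form p x + eigenline_form p y" for x y :: "'a^2^2"
    by (cases p) (simp_all add: algebra_simps)
  have "sl2.subspace (borel_subalgebra p)"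
    unfolding sl2.subspace_def borel_subalgebra_def
    using sl2.subspace_L by (auto simp: add sl2.subspace_def) (cases p; simp)
  moreover have "commutator x y \<in> borel_subalgebra p" if *: "x \<in> borel_subalgebra p" "y \<in> borel_subalgebra p" for x y
  proof -
    obtain a b c a' b' c' where xy: "x = traceless a b c" "y = traceless a' b' c'"
      using * by (auto simp: borel_subalgebra_def elim!: sl2_cases)
    show ?thesis
    proof (cases p)
      case (Some t)
      \<comment> \<open>The factors \<open>a - t * c\<close> and \<open>a' - t * c'\<close> are
        minus the second entries of \<open>x\<close> and \<open>y\<close> applied to
        \<open>(t, 1)\<close>.\<close>
      have "eigenline_form (Some t) (commutator x y) =
          2 * (a - t * c) * eigenline_form (Some t) y - 2 * (a' - t * c') * eigenline_form (Some t) x"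
        unfolding xy commutator_traceless by (simp add: algebra_simps power2_eq_square)
      then show ?thesis using * Some xy by (simp add: borel_subalgebra_def)
    qed (use * xy in \<open>simp add: borel_subalgebra_def\<close>)
  qed
  ultimately show ?thesis by (auto simp: sl2.lie_subalgebra_def borel_subalgebra_def)
qed


section \<open>Eigenlines of the vertices\<close>

definition eigenlines :: "('a::field^2^2) set \<Rightarrow> 'a option set" where
  "eigenlines A = {p. A \<subseteq> borel_subalgebra p}"

lemma eigenlines_matrix_in_borel_subalgebra_iff:
  assumes "(2::'a::field) \<noteq> 0"
  shows "eigenlines_matrix p p' \<in> borel_subalgebra (r :: 'a option) \<longleftrightarrow> r = p \<or> r = p'"
  using eigenline_form_eigenlines_matrix[OF assms] by (simp add: borel_subalgebra_def)

text \<open>The nilpotent matrix of \<open>p\<close> lies in the Borel subalgebra and has no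
  eigenline other than \<open>p\<close>.\<close>

lemma eigenlines_borel_subalgebra:
  assumes "(2::'a::field) \<noteq> 0"
  shows "eigenlines (borel_subalgebra p) = {p :: 'a option}"
proof -
  have "r = p" if "borel_subalgebra p \<subseteq> borel_subalgebra r" for r
    using eigenlines_matrix_in_borel_subalgebra_iff[OF assms, of p p] that by blast
  then show ?thesis by (auto simp: eigenlines_def)
qed

lemma subspace_borel_subalgebra: "sl2.subspace (borel_subalgebra (p :: 'a::{field,finite} option))"
  using lie_subalgebra_borel_subalgebra[of p] unfolding sl2.lie_subalgebra_def by simp

lemma eigenlines_span_eigenlines_matrix:
  assumes "(2::'a::{field,finite}) \<noteq> 0"
  shows "eigenlines (sl2.span {eigenlines_matrix p p'}) = {p, p' :: 'a option}"
proof -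
  have "sl2.span {x} \<subseteq> borel_subalgebra r \<longleftrightarrow> x \<in> borel_subalgebra r" for x and r :: "'a option"
    using sl2.span_minimal[OF _ subspace_borel_subalgebra, of "{x}" r] sl2.span_base[of x "{x}"] by auto
  then show ?thesis
    using eigenlines_matrix_in_borel_subalgebra_iff[OF assms] by (auto simp: eigenlines_def)
qed

text \<open>Equality would force \<open>p = p' = r\<close> by comparing labels. But for
  \<open>s \<noteq> r\<close> the Borel subalgebra also contains the matrix with eigenlines
  \<open>r\<close> and \<open>s\<close>, whose span has a different label.\<close>

lemma borel_subalgebra_neq_span_eigenlines_matrix:
  assumes "(2::'a::{field,finite}) \<noteq> 0"
  shows "borel_subalgebra r \<noteq> sl2.span {eigenlines_matrix p p' :: 'a^2^2}"
proof
  assume eq: "borel_subalgebra r = sl2.span {eigenlines_matrix p p'}"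
  then have "{p, p'} = {r}"
    using eigenlines_borel_subalgebra[OF assms] eigenlines_span_eigenlines_matrix[OF assms] by metis
  then have [simp]: "p = r" "p' = r" by auto
  obtain s where s: "s \<noteq> r" by (metis option.distinct(1))
  have "eigenlines_matrix r s \<in> sl2.span {eigenlines_matrix r r}"
    using eigenlines_matrix_in_borel_subalgebra_iff[OF assms, of r s r] eq by simp
  then have "sl2.span {eigenlines_matrix r s} = sl2.span {eigenlines_matrix r r}"
    by (rule sl2.span_singleton_eq) simp
  then have "{r, s} = {r, r}"
    using eigenlines_span_eigenlines_matrix[OF assms] by metis
  then show False using s by auto
qed

lemma span_eq_span_eigenlines_matrix:
  assumes "(2::'a::{field,finite}) \<noteq> 0" "x \<noteq> 0" "x \<in> borel_subalgebra p"
  obtains p' where "sl2.span {x} = sl2.span {eigenlines_matrix p p' :: 'a^2^2}"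
proof -
  obtain p' k where x: "x = smult_mat k (eigenlines_matrix p p')"
    using borel_subalgebra_factor[OF assms(1,3)] by blast
  have "sl2.span {x} = sl2.span {eigenlines_matrix p p'}"
    using x assms(2) by (intro sl2.span_singleton_eq) (auto simp: sl2.span_singleton)
  then show thesis by (rule that)
qed

lemma comaximal_vertices_sl2:
  assumes two: "(2::'a::{field,finite}) \<noteq> 0"
  shows "sl2.comaximal_vertices = (\<lambda>x. sl2.span {x}) ` (sl2 - {0}) \<union> range (borel_subalgebra :: 'a option \<Rightarrow> _)"
proof -
  have borel_subalgebra: "borel_subalgebra p \<in> sl2.comaximal_vertices" for p :: "'a option"
  proof -
    have "eigenlines_matrix p p \<in> borel_subalgebra p" using eigenlines_matrix_in_borel_subalgebra_iff[OF two, of p p p]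
      by simp
    then have "borel_subalgebra p \<noteq> {0}" using eigenlines_matrix_neq_0[of p p] by (metis singletonD)
    moreover obtain r where "r \<noteq> p" by (metis option.distinct(1))
    then have "eigenlines_matrix r r \<notin> borel_subalgebra p" using eigenlines_matrix_in_borel_subalgebra_iff[OF two, of r r p]
      by simp
    then have "borel_subalgebra p \<noteq> sl2" using eigenlines_matrix_in_sl2[of r r] by metis
    ultimately show ?thesis using lie_subalgebra_borel_subalgebra[of p] by (simp add: sl2.comaximal_vertices_def)
  qed
  have span: "sl2.span {x} \<in> sl2.comaximal_vertices" if x: "x \<in> sl2 - {0}" for x :: "'a^2^2"
  proof -
    have "sl2.span {x} \<noteq> sl2"
    proof
      assume "sl2.span {x} = sl2"
      \<comment> \<open>A line is abelian, while these two matrices do not commute.\<close>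
      then have "commutator (traceless 0 1 0) (traceless 0 0 1 :: 'a^2^2) = 0"
        using x by (intro sl2.bracket_span_singleton[of x]) simp_all
      then show False by simp
    qed
    moreover have "sl2.span {x} \<noteq> {0}" using x sl2.span_base[of x "{x}"] by auto
    ultimately show ?thesis
      using x sl2.lie_subalgebra_span_singleton[of x] by (simp add: sl2.comaximal_vertices_def)
  qed
  have "A \<in> (\<lambda>x. sl2.span {x}) ` (sl2 - {0}) \<union> range borel_subalgebra"
    if "A \<in> sl2.comaximal_vertices" for A :: "('a^2^2) set"
  proof -
    have "sl2.lie_subalgebra A" "A \<noteq> sl2" "A \<noteq> {0}"
      using that by (simp_all add: sl2.comaximal_vertices_def)
    then show ?thesis by (rule lie_subalgebra_sl2_cases[OF two]) auto
  qed
  then show ?thesis using borel_subalgebra span by auto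
qed

text \<open>This lists the vertices with nonempty label; the bound on label sizes and both
  multiplicities are read off from it.\<close>

lemma vertex_cases_of_eigenline:
  assumes "(2::'a::{field,finite}) \<noteq> 0" "A \<in> sl2.comaximal_vertices"
    and "(p :: 'a option) \<in> eigenlines A"
  shows "A = borel_subalgebra p \<or> (\<exists>p'. A = sl2.span {eigenlines_matrix p p'})"
proof -
  consider (span) x where "x \<noteq> 0" "A = sl2.span {x}" | (borel_subalgebra) p' where "A = borel_subalgebra p'"
    using assms(2) unfolding comaximal_vertices_sl2[OF assms(1)] by auto
  then show ?thesis
  proof cases
    case span
    then have "x \<in> borel_subalgebra p"
      using assms(3) sl2.span_base[of x "{x}"] by (auto simp: eigenlines_def)
    then show ?thesis using span span_eq_span_eigenlines_matrix[OF assms(1)] by metis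
  next
    case borel_subalgebra
    then show ?thesis using assms(3) eigenlines_borel_subalgebra[OF assms(1)] by auto
  qed
qed

lemma span_eigenlines_matrix_vertex:
  "(2::'a::{field,finite}) \<noteq> 0 \<Longrightarrow> sl2.span {eigenlines_matrix p p' :: 'a^2^2} \<in> sl2.comaximal_vertices"
  by (simp add: comaximal_vertices_sl2)

lemma card_eigenlines_le:
  assumes "(2::'a::{field,finite}) \<noteq> 0" "(A :: ('a^2^2) set) \<in> sl2.comaximal_vertices"
  shows "card (eigenlines A) \<le> 2"
proof (cases "eigenlines A = {}")
  case False
  then obtain p where "p \<in> eigenlines A" by blast
  from vertex_cases_of_eigenline[OF assms this] show ?thesis
    by (auto simp: eigenlines_borel_subalgebra[OF assms(1)] eigenlines_span_eigenlines_matrix[OF assms(1)]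
        card_insert_if)
qed simp

lemma card_vertices_one_eigenline:
  assumes "(2::'a::{field,finite}) \<noteq> 0"
  shows "card {A \<in> sl2.comaximal_vertices. eigenlines A = {p :: 'a option}} = 2"
proof -
  have "A = borel_subalgebra p \<or> A = sl2.span {eigenlines_matrix p p}"
    if "A \<in> sl2.comaximal_vertices" "eigenlines A = {p}" for A
    using vertex_cases_of_eigenline[OF assms that(1), of p] that(2)
    by (auto simp: eigenlines_span_eigenlines_matrix[OF assms])
  moreover have "borel_subalgebra p \<in> sl2.comaximal_vertices" by (simp add: comaximal_vertices_sl2[OF assms])
  ultimately have "{A \<in> sl2.comaximal_vertices. eigenlines A = {p}} =
      {borel_subalgebra p, sl2.span {eigenlines_matrix p p}}"
    by (auto simp: eigenlines_borel_subalgebra[OF assms] eigenlines_span_eigenlines_matrix[OF assms]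
        span_eigenlines_matrix_vertex[OF assms])
  then show ?thesis using borel_subalgebra_neq_span_eigenlines_matrix[OF assms] by simp
qed

lemma card_vertices_two_eigenlines:
  assumes "(2::'a::{field,finite}) \<noteq> 0" "p \<noteq> p'"
  shows "card {A \<in> sl2.comaximal_vertices. eigenlines A = {p, p' :: 'a option}} = 1"
proof -
  have "A = sl2.span {eigenlines_matrix p p'}"
    if A: "A \<in> sl2.comaximal_vertices" "eigenlines A = {p, p'}" for A
  proof -
    have "A \<noteq> borel_subalgebra p" using A(2) assms(2) by (auto simp: eigenlines_borel_subalgebra[OF assms(1)])
    then obtain p'' where p'': "A = sl2.span {eigenlines_matrix p p''}"
      using vertex_cases_of_eigenline[OF assms(1) A(1), of p] A(2) by auto
    then have "{p, p''} = {p, p'}"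
      using A(2) by (simp add: eigenlines_span_eigenlines_matrix[OF assms(1)])
    then show ?thesis using p'' assms(2) by (auto simp: doubleton_eq_iff)
  qed
  then have "{A \<in> sl2.comaximal_vertices. eigenlines A = {p, p'}} =
      {sl2.span {eigenlines_matrix p p'}}"
    by (auto simp: eigenlines_span_eigenlines_matrix[OF assms(1)] span_eigenlines_matrix_vertex[OF assms(1)])
  then show ?thesis by simp
qed

section \<open>The number of vertices\<close>

lemma (in vector_space) card_span_singleton:
  assumes "x \<noteq> 0"
  shows "card (span {x}) = CARD('a)"
  using assms by (simp add: span_singleton card_image inj_on_def)

text \<open>Nonzero matrices are grouped by the line they span, and each line has
  \<open>CARD('a) - 1\<close> generators.\<close>

lemma card_spans_sl2:
  "(CARD('a) - 1) * card ((\<lambda>x. sl2.span {x}) ` (sl2 - {0 :: 'a::{field,finite}^2^2})) = CARD('a) ^ 3 - 1"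
proof -
  let ?V = "sl2 - {0 :: 'a^2^2}"
  have "card {y \<in> ?V. sl2.span {y} = sl2.span {x}} = CARD('a) - 1" if x: "x \<in> ?V" for x
  proof -
    have "sl2.span {x} \<subseteq> sl2"
      using x by (intro sl2.span_minimal sl2.subspace_L) auto
    moreover have "sl2.span {y} = sl2.span {x}" if "y \<in> sl2.span {x}" "y \<noteq> 0" for y
      using that by (rule sl2.span_singleton_eq)
    ultimately have "{y \<in> ?V. sl2.span {y} = sl2.span {x}} = sl2.span {x} - {0}"
      using sl2.span_base by blast
    then show ?thesis
      using x by (simp add: sl2.card_span_singleton sl2.span_zero card_Diff_singleton)
  qed
  then have "(\<Sum>l\<in>(\<lambda>x. sl2.span {x}) ` ?V. card {y \<in> ?V. sl2.span {y} = l}) =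
      (\<Sum>l\<in>(\<lambda>x. sl2.span {x}) ` ?V. CARD('a) - 1)"
    by (intro sum.cong refl) blast
  then have "card ?V = (\<Sum>l\<in>(\<lambda>x. sl2.span {x}) ` ?V. CARD('a) - 1)"
    using sum.image_gen[of ?V "\<lambda>_. 1::nat" "\<lambda>x. sl2.span {x}"] by simp
  moreover have "card ?V = CARD('a) ^ 3 - 1"
  proof -
    have "(0 :: 'a^2^2) \<in> sl2" by (rule sl2.subspace_0[OF sl2.subspace_L])
    then show ?thesis by (simp add: card_sl2 card_Diff_singleton)
  qed
  ultimately show ?thesis by simp
qed

lemma span_neq_borel_subalgebra:
  assumes "(2::'a::{field,finite}) \<noteq> 0"
  shows "sl2.span {x} \<noteq> borel_subalgebra (p :: 'a option)"
proof
  assume eq: "sl2.span {x} = borel_subalgebra p"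
  then have "x \<in> borel_subalgebra p" using sl2.span_base[of x "{x}"] by auto
  moreover have "x \<noteq> 0"
  proof
    assume "x = 0"
    then have "borel_subalgebra p = {0}" using eq by (auto simp: sl2.span_singleton)
    then show False using eigenlines_matrix_in_borel_subalgebra_iff[OF assms, of p p p] by simp
  qed
  ultimately show False
    using span_eq_span_eigenlines_matrix[OF assms] borel_subalgebra_neq_span_eigenlines_matrix[OF assms] eq by metis
qed

lemma card_comaximal_vertices_sl2:
  assumes "(2::'a::{field,finite}) \<noteq> 0"
  shows "card (sl2.comaximal_vertices :: ('a^2^2) set set) = CARD('a)\<^sup>2 + 2 * CARD('a) + 2"
proof -
  let ?S = "(\<lambda>x. sl2.span {x}) ` (sl2 - {0 :: 'a^2^2})"
  have q: "CARD('a) > 1" using card_mono[of UNIV "{0, 1 :: 'a}"] by simp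
  have "(CARD('a) - 1) * card ?S = (CARD('a) - 1) * (CARD('a)\<^sup>2 + CARD('a) + 1)"
    unfolding card_spans_sl2 using q
    by (cases "CARD('a)") (simp_all add: power2_eq_square power3_eq_cube algebra_simps)
  then have "card ?S = CARD('a)\<^sup>2 + CARD('a) + 1"
    using q by (metis mult_left_cancel less_numeral_extra(3) zero_less_diff)
  \<comment> \<open>The map to Borel subalgebras is injective because the label recovers
    \<open>p\<close>.\<close>
  moreover have "card (range (borel_subalgebra :: 'a option \<Rightarrow> _)) = CARD('a) + 1"
    using eigenlines_borel_subalgebra[OF assms] by (subst card_image)
      (metis injI singleton_inject, simp add: card_UNIV_option)
  moreover have "?S \<inter> range (borel_subalgebra :: 'a option \<Rightarrow> _) = {}"
    unfolding disjoint_iff image_iff using span_neq_borel_subalgebra[OF assms] by metis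
  ultimately show ?thesis
    unfolding comaximal_vertices_sl2[OF assms] by (simp add: card_Un_disjoint)
qed

section \<open>Adjacency as disjointness of labels\<close>

text \<open>If the generated subalgebra is proper, the classification leaves a line or a Borel
  subalgebra, and two distinct vertices do not fit into a line.\<close>

lemma comaximal_adj_sl2_iff:
  fixes A B :: "('a::{field,finite}^2^2) set"
  assumes two: "(2::'a) \<noteq> 0" and AB: "A \<in> sl2.comaximal_vertices" "B \<in> sl2.comaximal_vertices" "A \<noteq> B"
  shows "sl2.comaximal_adj A B \<longleftrightarrow> eigenlines A \<inter> eigenlines B = {}"
proof -
  let ?H = "sl2.lie_subalgebra hull (A \<union> B)"
  have A: "sl2.subspace A" "A \<noteq> {0}" "A \<subseteq> sl2" and B: "sl2.subspace B" "B \<noteq> {0}" "B \<subseteq> sl2"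
    using AB by (auto simp: sl2.comaximal_vertices_def sl2.lie_subalgebra_def)
  have sub: "A \<subseteq> ?H" "B \<subseteq> ?H" using hull_subset[of "A \<union> B" sl2.lie_subalgebra] by auto
  have "?H \<noteq> sl2 \<longleftrightarrow> (\<exists>p. A \<subseteq> borel_subalgebra p \<and> B \<subseteq> borel_subalgebra p)"
  proof
    assume H: "?H \<noteq> sl2"
    have "?H \<noteq> {0}" using sub A sl2.subspace_0[OF A(1)] by auto
    with H show "\<exists>p. A \<subseteq> borel_subalgebra p \<and> B \<subseteq> borel_subalgebra p"
    proof (cases rule: lie_subalgebra_sl2_cases[OF two sl2.lie_subalgebra_hull, of "A \<union> B"])
      case (4 x)
      \<comment> \<open>The hull is a line here; its only nonzero subspace is itself, so
        \<open>A\<close> and \<open>B\<close> would coincide.\<close>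
      then show ?thesis
        using sl2.subspace_of_span_singleton A B sub AB(3) by metis
    qed (use sub A B in auto)
  next
    assume "\<exists>p. A \<subseteq> borel_subalgebra p \<and> B \<subseteq> borel_subalgebra p"
    then obtain p where "A \<union> B \<subseteq> borel_subalgebra p" by auto
    then have "?H \<subseteq> borel_subalgebra p" using hull_minimal lie_subalgebra_borel_subalgebra by metis
    moreover have "borel_subalgebra p \<subset> sl2"
      using comaximal_vertices_sl2[OF two]
      by (fastforce simp: sl2.comaximal_vertices_def sl2.lie_subalgebra_def)
    ultimately show "?H \<noteq> sl2" by auto
  qed
  then show ?thesis
    using AB by (auto simp: sl2.comaximal_adj_def eigenlines_def)
qed

section \<open>The number of triangles\<close>

text \<open>The characteristic divides the number of elements, so it cannot be 2.\<close>

lemma two_neq_0_if_odd_card: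
  assumes "odd CARD('a::{field,finite})"
  shows "(2::'a) \<noteq> 0"
proof
  assume "(2::'a) = 0"
  then have "of_nat 2 = (0::'a)" by simp
  then have "CHAR('a) dvd 2" by (simp only: of_nat_eq_0_iff_char_dvd)
  moreover have "CHAR('a) \<noteq> 1" using CHAR_not_1' by simp
  ultimately have "CHAR('a) = 2" using two_is_prime_nat prime_nat_iff by blast
  then show False using CHAR_dvd_CARD[where 'a = 'a] assms by simp
qed

theorem proposition3p14:
  fixes q :: nat
  assumes "q = CARD('a::{field,finite})" and "odd q"
  shows "real (sl2.num_triangles TYPE('a)) =
    real q ^ 2 * (real q ^ 2 - 1) * (real q ^ 2 + 3 * real q + 3) / 6"
proof -
  have two: "(2::'a) \<noteq> 0" using assms by (intro two_neq_0_if_odd_card) simp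
  have "real (card (triangles (sl2.comaximal_vertices :: ('a^2^2) set set) sl2.comaximal_adj)) =
    (real q)\<^sup>2 * ((real q)\<^sup>2 - 1) * ((real q)\<^sup>2 + 3 * real q + 3) / 6"
  proof (rule card_triangles_disjoint_labels[where S = eigenlines])
    show "sl2.comaximal_adj B A" if "sl2.comaximal_adj A B" for A B :: "('a^2^2) set"
      using that by (auto simp: sl2.comaximal_adj_def Un_commute)
  qed (simp_all add: two assms(1) card_eigenlines_le card_vertices_one_eigenline
      card_vertices_two_eigenlines comaximal_adj_sl2_iff card_comaximal_vertices_sl2 card_UNIV_option)
  then show ?thesis by (simp only: sl2.num_triangles_def)
qed

end
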